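(* Let $H$ be an abelian group. The family of maps $P^{st}_T\colon G^\circ\to A^{st}(T)$, where $T=(G,s,b)$ ranges over the based matrices with coefficients in $H$, $A^{st}(T)=\mathbb Z[G^\circ]/Ann(\mathfrak C_\infty(T))$ and $P^{st}_T$ sends $g$ to its coset, is a parity functor on based matrices with coefficients in the groups $A^{st}(T)$.
   Context: **Based matrices.** A based matrix with coefficients in an abelian group $H$ is a triple $T=(G,s,b)$ with $G$ a finite set, $s\in G$, and $b\colon G\times G\to H$ such that $b(h,g)=-b(g,h)$ for all $g,h\in G$. Put $G^\circ=G\setminus\{s\}$. Extend $b$ biadditively to $\mathbb Z[G]$, and for $C\subset G$ put $\chi_C=\sum_{g\in C}g$. An element $g\in G^\circ$ is annihilating if $b(g,h)=0$ for all $h\in G$, and core if $b(g,h)=b(s,h)$ for all $h\in G$. Elements $g_1,g_2\in G^\circ$ are complementary if $b(g_1,h)+b(g_2,h)=b(s,h)$ for all $h\in G$. Operation $M_1$ (resp. $M_2$) replaces $(G,s,b)$ by $(G\sqcup\{g\},s,b')$ with $b'$ extending $b$ and $g$ annihilating (resp. core); operation $M_3$ replaces it by $(G\sqcup\{g,g'\},s,b')$ with $b'$ any skew-symmetric extension of $b$ for which $g,g'$ are complementary. **Parity functor.** A parity functor on based matrices is a family of maps $P_T\colon G\to A(T)$ into abelian groups $A(T)$, one for each based matrix $T=(G,s,b)$, such that: (P0) if $T'$ is obtained from $T=(G,s,b)$ by an operation $f$ of type $M_1,M_2$ or $M_3$, then there is a fixed monomorphism $A(f)\colon A(T)\to A(T')$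 with $P_{T'}(g)=A(f)(P_T(g))$ for all $g\in G$; (P1) $P_T(g)=0$ if $g$ is annihilating or core, or $g=s$; (P2) $P_T(g_1)+P_T(g_2)=0$ if $g_1,g_2$ are complementary; (P3) if $g_1,g_2,g_3\in G^\circ$ satisfy $b(g_1,h)+b(g_2,h)+b(g_3,h)=b(s,h)$ for all $h\in G$, then $P_T(g_1)+P_T(g_2)+P_T(g_3)=0$. Maps given on $G^\circ$ only are extended by $P_T(s)=0$. **Stable partition.** For a partition $\mathfrak C$ of $G$ with $\{s\}\in\mathfrak C$, the annulator is $$Ann(\mathfrak C)=\{v\in\mathbb Z[G^\circ]\mid\exists k\in\mathbb Z:\ \forall C\in\mathfrak C\ \ b(v,\chi_C)=k\cdot b(s,\chi_C)\},$$ and the derived partition $A\mathfrak C$ consists of $\{s\}$ and the equivalence classes of the relation on $G^\circ$: $g_1\simeq g_2$ iff $g_1-g_2\in Ann(\mathfrak C)$ or $g_1+g_2\in Ann(\mathfrak C)$. Let $\mathfrak C_0$ be the partition of $G$ into one-element sets and $\mathfrak C_n=A^n\mathfrak C_0$. Each $\mathfrak C_n$ is a refinement of $\mathfrak C_{n+1}$, and since $G$ is finite the sequence stabilizes; its eventual value is the stable partition $\mathfrak C_\infty(T)$. *)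

theory Defs
  imports "HOL-Algebra.Free_Abelian_Groups" Complex_Main
begin

text \<open>
  The coefficient group \<open>H\<close> is written multiplicatively, as everywhere in HOL-Algebra:
  \<open>- x\<close> is \<open>inv\<^bsub>H\<^esub> x\<close>, and \<open>k \<cdot> x\<close> for an integer \<open>k\<close> is \<open>x [^]\<^bsub>H\<^esub> k\<close>.
\<close>

record ('g, 'h) based_matrix =
  elems :: "'g set"
  base :: 'g
  form :: "'g \<times> 'g \<Rightarrow> 'h"

definition nonbase :: "('g, 'h) based_matrix \<Rightarrow> 'g set" where
  "nonbase T = elems T - {base T}"

text \<open>
  The form is an extensional function on \<open>G \<times> G\<close>, so that equality of records is equality of
  based matrices.
\<close>

definition based_matrix :: "('h, 'm) monoid_scheme \<Rightarrow> ('g, 'h) based_matrix \<Rightarrow> bool" where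
  "based_matrix H T \<longleftrightarrow>
     finite (elems T) \<and> base T \<in> elems T \<and>
     form T \<in> elems T \<times> elems T \<rightarrow>\<^sub>E carrier H \<and>
     (\<forall>g\<in>elems T. \<forall>h\<in>elems T. form T (h, g) = inv\<^bsub>H\<^esub> form T (g, h))"

definition annihilating :: "('h, 'm) monoid_scheme \<Rightarrow> ('g, 'h) based_matrix \<Rightarrow> 'g \<Rightarrow> bool" where
  "annihilating H T g \<longleftrightarrow>
     g \<in> nonbase T \<and> (\<forall>h\<in>elems T. form T (g, h) = \<one>\<^bsub>H\<^esub>)"

definition core :: "('g, 'h) based_matrix \<Rightarrow> 'g \<Rightarrow> bool" where
  "core T g \<longleftrightarrow>
     g \<in> nonbase T \<and> (\<forall>h\<in>elems T. form T (g, h) = form T (base T, h))"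

definition complementary ::
    "('h, 'm) monoid_scheme \<Rightarrow> ('g, 'h) based_matrix \<Rightarrow> 'g \<Rightarrow> 'g \<Rightarrow> bool" where
  "complementary H T g1 g2 \<longleftrightarrow>
     g1 \<in> nonbase T \<and> g2 \<in> nonbase T \<and>
     (\<forall>h\<in>elems T. form T (g1, h) \<otimes>\<^bsub>H\<^esub> form T (g2, h) = form T (base T, h))"

definition enlarges_by ::
    "('h, 'm) monoid_scheme \<Rightarrow> ('g, 'h) based_matrix \<Rightarrow> 'g set \<Rightarrow> ('g, 'h) based_matrix \<Rightarrow> bool" where
  "enlarges_by H T N T' \<longleftrightarrow>
     based_matrix H T \<and> based_matrix H T' \<and>
     N \<inter> elems T = {} \<and> elems T' = elems T \<union> N \<and> base T' = base T \<and>
     (\<forall>x\<in>elems T. \<forall>y\<in>elems T. form T' (x, y) = form T (x, y))"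

definition M1 ::
    "('h, 'm) monoid_scheme \<Rightarrow> ('g, 'h) based_matrix \<Rightarrow> ('g, 'h) based_matrix \<Rightarrow> bool" where
  "M1 H T T' \<longleftrightarrow> (\<exists>g. enlarges_by H T {g} T' \<and> annihilating H T' g)"

definition M2 ::
    "('h, 'm) monoid_scheme \<Rightarrow> ('g, 'h) based_matrix \<Rightarrow> ('g, 'h) based_matrix \<Rightarrow> bool" where
  "M2 H T T' \<longleftrightarrow> (\<exists>g. enlarges_by H T {g} T' \<and> core T' g)"

definition M3 ::
    "('h, 'm) monoid_scheme \<Rightarrow> ('g, 'h) based_matrix \<Rightarrow> ('g, 'h) based_matrix \<Rightarrow> bool" where
  "M3 H T T' \<longleftrightarrow>
     (\<exists>g g'. g \<noteq> g' \<and> enlarges_by H T {g, g'} T' \<and> complementary H T' g g')"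

text \<open>
  The groups \<open>A T\<close> are multiplicative as well, so the neutral element is \<open>\<one>\<^bsub>A T\<^esub>\<close>.
\<close>

definition parity_functor ::
    "('h, 'm) monoid_scheme \<Rightarrow> (('g, 'h) based_matrix \<Rightarrow> ('a, 'n) monoid_scheme) \<Rightarrow>
     (('g, 'h) based_matrix \<Rightarrow> 'g \<Rightarrow> 'a) \<Rightarrow> bool" where
  "parity_functor H A P \<longleftrightarrow>
     (\<forall>T. based_matrix H T \<longrightarrow> comm_group (A T) \<and> P T \<in> elems T \<rightarrow> carrier (A T)) \<and>
     (\<forall>T T'. M1 H T T' \<or> M2 H T T' \<or> M3 H T T' \<longrightarrow>
        (\<exists>\<phi>\<in>mon (A T) (A T'). \<forall>g\<in>elems T. P T' g = \<phi> (P T g))) \<and>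
     (\<forall>T g. based_matrix H T \<longrightarrow>
        annihilating H T g \<or> core T g \<or> g = base T \<longrightarrow> P T g = \<one>\<^bsub>A T\<^esub>) \<and>
     (\<forall>T g1 g2. based_matrix H T \<longrightarrow>
        complementary H T g1 g2 \<longrightarrow> P T g1 \<otimes>\<^bsub>A T\<^esub> P T g2 = \<one>\<^bsub>A T\<^esub>) \<and>
     (\<forall>T. based_matrix H T \<longrightarrow>
        (\<forall>g1\<in>nonbase T. \<forall>g2\<in>nonbase T. \<forall>g3\<in>nonbase T.
           (\<forall>h\<in>elems T. form T (g1, h) \<otimes>\<^bsub>H\<^esub> form T (g2, h) \<otimes>\<^bsub>H\<^esub> form T (g3, h)
                           = form T (base T, h)) \<longrightarrow>
           P T g1 \<otimes>\<^bsub>A T\<^esub> P T g2 \<otimes>\<^bsub>A T\<^esub> P T g3 = \<one>\<^bsub>A T\<^esub>))"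

definition bext ::
    "('h, 'm) monoid_scheme \<Rightarrow> ('g, 'h) based_matrix \<Rightarrow> ('g \<Rightarrow>\<^sub>0 int) \<Rightarrow> ('g \<Rightarrow>\<^sub>0 int) \<Rightarrow> 'h" where
  "bext H T v w =
     (\<Otimes>\<^bsub>H\<^esub>g\<in>Poly_Mapping.keys v. \<Otimes>\<^bsub>H\<^esub>h\<in>Poly_Mapping.keys w.
        form T (g, h) [^]\<^bsub>H\<^esub> (Poly_Mapping.lookup v g * Poly_Mapping.lookup w h))"

definition chi :: "'g set \<Rightarrow> 'g \<Rightarrow>\<^sub>0 int" where
  "chi C = (\<Sum>g\<in>C. frag_of g)"

definition Ann ::
    "('h, 'm) monoid_scheme \<Rightarrow> ('g, 'h) based_matrix \<Rightarrow> 'g set set \<Rightarrow> ('g \<Rightarrow>\<^sub>0 int) set" where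
  "Ann H T \<CC> =
     {v \<in> carrier (free_Abelian_group (nonbase T)).
        \<exists>k::int. \<forall>C\<in>\<CC>. bext H T v (chi C) = bext H T (frag_of (base T)) (chi C) [^]\<^bsub>H\<^esub> k}"

definition derived_partition ::
    "('h, 'm) monoid_scheme \<Rightarrow> ('g, 'h) based_matrix \<Rightarrow> 'g set set \<Rightarrow> 'g set set" where
  "derived_partition H T \<CC> =
     insert {base T}
       (nonbase T // {(g1, g2). g1 \<in> nonbase T \<and> g2 \<in> nonbase T \<and>
          (frag_of g1 - frag_of g2 \<in> Ann H T \<CC> \<or> frag_of g1 + frag_of g2 \<in> Ann H T \<CC>)})"

definition partition_seq ::
    "('h, 'm) monoid_scheme \<Rightarrow> ('g, 'h) based_matrix \<Rightarrow> nat \<Rightarrow> 'g set set" where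
  "partition_seq H T n = (derived_partition H T ^^ n) ((\<lambda>g. {g}) ` elems T)"

text \<open>
  Each term of the sequence refines the next one and the base set is finite, so the sequence is
  eventually constant and exactly one value satisfies the description below.
\<close>

definition stable_partition ::
    "('h, 'm) monoid_scheme \<Rightarrow> ('g, 'h) based_matrix \<Rightarrow> 'g set set" where
  "stable_partition H T = (THE \<CC>. \<forall>\<^sub>F n in sequentially. partition_seq H T n = \<CC>)"

definition A_st ::
    "('h, 'm) monoid_scheme \<Rightarrow> ('g, 'h) based_matrix \<Rightarrow> ('g \<Rightarrow>\<^sub>0 int) set monoid" where
  "A_st H T = free_Abelian_group (nonbase T) Mod Ann H T (stable_partition H T)"

definition P_st ::
    "('h, 'm) monoid_scheme \<Rightarrow> ('g, 'h) based_matrix \<Rightarrow> 'g \<Rightarrow> ('g \<Rightarrow>\<^sub>0 int) set" where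
  "P_st H T g =
     (if g = base T then \<one>\<^bsub>A_st H T\<^esub>
      else Ann H T (stable_partition H T) #>\<^bsub>free_Abelian_group (nonbase T)\<^esub> frag_of g)"

end

theory Submission
  imports Defs "HOL-Library.Disjoint_Sets"
begin

text \<open>
  The stable partition is the finest fixed point of the monotone operator \<open>A\<close>. An operation of type
  \<open>M\<^sub>1\<close>, \<open>M\<^sub>2\<close> or \<open>M\<^sub>3\<close> adds a set \<open>N\<close> with \<open>b(\<chi>\<^sub>N, h) = e b(s, h)\<close> for all \<open>h\<close> and some
  \<open>e \<in> {0, 1}\<close>. By skew-symmetry a class that contains \<open>s\<close> alone forces
  every condition coming from \<open>\<chi>\<^sub>N\<close>. As \<open>N\<close> lies in one class of each derived partition
  of \<open>T'\<close>, the restriction of \<open>\<CC>\<^sub>\<infinity>(T')\<close> to \<open>G\<close> is closed under \<open>A\<close>, hence is coarser than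
  \<open>\<CC>\<^sub>\<infinity>(T)\<close>; conversely the restriction of \<open>\<CC>\<^sub>n(T')\<close> refines \<open>\<CC>\<^sub>n(T)\<close>. At \<open>n = 0\<close> an
  operation \<open>M\<^sub>3\<close> adds two singleton classes, which may impose new conditions; hence the
  annulators need to match only in the limit. The inclusion of free groups then induces the required monomorphism.
\<close>

section \<open>Finite products in commutative groups\<close>

lemma (in comm_group) finprod_swap:
  assumes "finite A" "finite B" "\<And>x y. x \<in> A \<Longrightarrow> y \<in> B \<Longrightarrow> f x y \<in> carrier G"
  shows "(\<Otimes>x\<in>A. \<Otimes>y\<in>B. f x y) = (\<Otimes>y\<in>B. \<Otimes>x\<in>A. f x y)"
  using assms(1,3)
proof (induction A)
  case empty
  then show ?case by simp
next
  case (insert a A)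
  have "(\<Otimes>x\<in>insert a A. \<Otimes>y\<in>B. f x y) = (\<Otimes>y\<in>B. f a y) \<otimes> (\<Otimes>y\<in>B. \<Otimes>x\<in>A. f x y)"
    using insert by (subst finprod_insert) (auto intro!: finprod_closed)
  also have "\<dots> = (\<Otimes>y\<in>B. f a y \<otimes> (\<Otimes>x\<in>A. f x y))"
    using insert by (subst finprod_multf) (auto intro!: finprod_closed)
  also have "\<dots> = (\<Otimes>y\<in>B. \<Otimes>x\<in>insert a A. f x y)"
    using insert by (intro finprod_cong) (auto simp: simp_implies_def)
  finally show ?case .
qed

text \<open>Taking a k-th power is an endomorphism of a commutative group. For infinite
  \<open>A\<close> both sides are neutral, since \<open>finprod\<close> then takes the value
  \<open>\<one>\<close>.\<close>

lemma (in comm_group) finprod_int_pow: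
  fixes k :: int
  assumes "f \<in> A \<rightarrow> carrier G"
  shows "(\<Otimes>x\<in>A. f x [^] k) = (\<Otimes>x\<in>A. f x) [^] k"
  using assms
  by (induction A rule: infinite_finite_induct) (auto simp: int_pow_distrib Pi_def)

section \<open>The form evaluated on sums over classes\<close>

text \<open>This is b(w, \<chi>_C) for w supported on G. The inner product runs over all of G
  instead of the support of w, so that additivity in w holds factor by factor; the outer index h
  makes additivity in C a matter of disjoint unions.\<close>

definition pairing ::
    "('h, 'm) monoid_scheme \<Rightarrow> ('g, 'h) based_matrix \<Rightarrow> ('g \<Rightarrow>\<^sub>0 int) \<Rightarrow> 'g set \<Rightarrow> 'h" where
  "pairing H T w C =
     (\<Otimes>\<^bsub>H\<^esub>h\<in>C. \<Otimes>\<^bsub>H\<^esub>g\<in>elems T. form T (g, h) [^]\<^bsub>H\<^esub> Poly_Mapping.lookup w g)"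

text \<open>The relation written out inside \<open>derived_partition\<close>, named so that the
  theory of equivalences and quotients applies to it.\<close>

definition ann_rel ::
    "('h, 'm) monoid_scheme \<Rightarrow> ('g, 'h) based_matrix \<Rightarrow> 'g set set \<Rightarrow> ('g \<times> 'g) set" where
  "ann_rel H T \<CC> = {(g1, g2). g1 \<in> nonbase T \<and> g2 \<in> nonbase T \<and>
     (frag_of g1 - frag_of g2 \<in> Ann H T \<CC> \<or> frag_of g1 + frag_of g2 \<in> Ann H T \<CC>)}"

lemma derived_partition_eq:
  "derived_partition H T \<CC> = insert {base T} (nonbase T // ann_rel H T \<CC>)"
  by (simp add: derived_partition_def ann_rel_def)

locale based_matrix_over = comm_group H
  for H :: "('h, 'm) monoid_scheme" (structure) +
  fixes T :: "('g, 'h) based_matrix"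
  assumes based_matrix: "based_matrix H T"
begin

lemma finite_elems [simp, intro]: "finite (elems T)"
  and base_in_elems [simp, intro]: "base T \<in> elems T"
  and form_closed [simp, intro]: "g \<in> elems T \<Longrightarrow> h \<in> elems T \<Longrightarrow> form T (g, h) \<in> carrier H"
  and form_skew: "g \<in> elems T \<Longrightarrow> h \<in> elems T \<Longrightarrow> form T (h, g) = inv form T (g, h)"
  using based_matrix unfolding based_matrix_def by blast+

lemma nonbase_subset: "nonbase T \<subseteq> elems T"
  by (auto simp: nonbase_def)

lemma finite_subset_elems: "C \<subseteq> elems T \<Longrightarrow> finite C"
  using finite_subset by blast

lemma pairing_closed [simp, intro]: "C \<subseteq> elems T \<Longrightarrow> pairing H T w C \<in> carrier H"
  unfolding pairing_def by (intro finprod_closed) (auto intro!: finprod_closed)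

lemma pairing_empty [simp]: "pairing H T w {} = \<one>"
  by (simp add: pairing_def)

lemma pairing_Un_disjoint:
  assumes "C \<subseteq> elems T" "D \<subseteq> elems T" "C \<inter> D = {}"
  shows "pairing H T w (C \<union> D) = pairing H T w C \<otimes> pairing H T w D"
  unfolding pairing_def using assms finite_subset_elems
  by (intro finprod_Un_disjoint) (auto intro!: finprod_closed)

lemma pairing_add:
  assumes "C \<subseteq> elems T"
  shows "pairing H T (v + w) C = pairing H T v C \<otimes> pairing H T w C"
proof -
  have "pairing H T (v + w) C =
      (\<Otimes>h\<in>C. \<Otimes>g\<in>elems T. form T (g, h) [^] Poly_Mapping.lookup v g
                              \<otimes> form T (g, h) [^] Poly_Mapping.lookup w g)"
    unfolding pairing_def using assms
    by (intro finprod_cong)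
      (auto simp: simp_implies_def lookup_add int_pow_mult dest!: subsetD[OF assms]
        intro!: finprod_closed finprod_cong)
  also have "\<dots> = (\<Otimes>h\<in>C. (\<Otimes>g\<in>elems T. form T (g, h) [^] Poly_Mapping.lookup v g)
      \<otimes> (\<Otimes>g\<in>elems T. form T (g, h) [^] Poly_Mapping.lookup w g))"
    using assms by (intro finprod_cong) (auto simp: simp_implies_def intro!: finprod_closed)
  also have "\<dots> = pairing H T v C \<otimes> pairing H T w C"
    unfolding pairing_def using assms by (intro finprod_multf) (auto intro!: finprod_closed)
  finally show ?thesis .
qed

lemma pairing_cmul:
  assumes "C \<subseteq> elems T"
  shows "pairing H T (frag_cmul k v) C = pairing H T v C [^] k"
proof -
  have "pairing H T (frag_cmul k v) C =
      (\<Otimes>h\<in>C. \<Otimes>g\<in>elems T. (form T (g, h) [^] Poly_Mapping.lookup v g) [^] k)"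
    unfolding pairing_def using assms
    by (intro finprod_cong)
      (auto simp: simp_implies_def int_pow_pow mult.commute dest!: subsetD[OF assms]
        intro!: finprod_closed finprod_cong)
  also have "\<dots> = (\<Otimes>h\<in>C. (\<Otimes>g\<in>elems T. form T (g, h) [^] Poly_Mapping.lookup v g) [^] k)"
    using assms by (intro finprod_cong) (auto simp: simp_implies_def finprod_int_pow
        intro!: finprod_closed)
  also have "\<dots> = pairing H T v C [^] k"
    unfolding pairing_def using assms by (intro finprod_int_pow) (auto intro!: finprod_closed)
  finally show ?thesis .
qed

lemma pairing_uminus:
  assumes "C \<subseteq> elems T"
  shows "pairing H T (- v) C = inv pairing H T v C"
proof -
  have "pairing H T (- v) C = pairing H T v C [^] (- 1 :: int)"
    using pairing_cmul[OF assms, of "- 1" v] by (simp only: frag_cmul_minus_one)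
  also have "\<dots> = inv (pairing H T v C [^] (1 :: int))"
    using assms by (intro int_pow_neg pairing_closed)
  finally show ?thesis using assms by (simp only: int_pow_1 pairing_closed)
qed

lemma pairing_diff:
  assumes "C \<subseteq> elems T"
  shows "pairing H T (v - w) C = pairing H T v C \<otimes> inv pairing H T w C"
  unfolding pairing_uminus[OF assms, symmetric] pairing_add[OF assms, symmetric] by simp

lemma pairing_frag_of:
  assumes "C \<subseteq> elems T" "g \<in> elems T"
  shows "pairing H T (frag_of g) C = (\<Otimes>h\<in>C. form T (g, h))"
proof -
  have "(\<Otimes>x\<in>elems T. form T (x, h) [^] Poly_Mapping.lookup (frag_of g) x) = form T (g, h)"
    if "h \<in> C" for h
  proof -
    have h: "h \<in> elems T" using assms(1) that by (rule subsetD)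
    have closed: "(\<lambda>x. form T (x, h) [^] Poly_Mapping.lookup (frag_of g) x) \<in> elems T \<rightarrow> carrier H"
      using h by (intro Pi_I int_pow_closed form_closed)
    have "(\<Otimes>x\<in>elems T. form T (x, h) [^] Poly_Mapping.lookup (frag_of g) x) =
          (\<Otimes>x\<in>{g}. form T (x, h))"
      using assms(2) h closed by (intro finprod_mono_neutral_cong_right) simp_all
    also have "\<dots> = form T (g, h)"
      using assms(2) h by simp
    finally show ?thesis .
  qed
  then show ?thesis
    unfolding pairing_def using assms
    by (intro finprod_cong) (auto simp: simp_implies_def)
qed

text \<open>The value at D is the product of the values at the finitely many parts. This carries
  conditions from a fine partition to a coarse one.\<close>

lemma pairing_Union_eq_one:
  assumes "partition_on D PP" "D \<subseteq> elems T" "\<And>C. C \<in> PP \<Longrightarrow> pairing H T w C = \<one>"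
  shows "pairing H T w D = \<one>"
proof -
  have sub: "C \<subseteq> elems T" if "C \<in> PP" for C
    using assms(1,2) that by (auto simp: partition_on_def)
  have fin: "finite PP"
    using assms(1,2) finite_elements finite_subset_elems by blast
  have "pairing H T w D = (\<Otimes>C\<in>PP. pairing H T w C)"
    unfolding pairing_def partition_onD1[OF assms(1)]
  proof (rule finprod_Union_disjoint[OF fin])
    show "pairwise disjnt PP" using assms(1) by (simp add: partition_on_def)
  next
    fix C assume "C \<in> PP"
    then have "C \<subseteq> elems T" by (rule sub)
    then show "finite C \<and> (\<forall>h\<in>C. (\<Otimes>g\<in>elems T. form T (g, h) [^] Poly_Mapping.lookup w g) \<in> carrier H)"
      by (auto simp: finite_subset_elems intro!: finprod_closed)
  qed
  also have "\<dots> = \<one>"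
    using assms(3) by (intro finprod_one_eqI) auto
  finally show ?thesis .
qed

section \<open>Annulators as subgroups of the free group\<close>

text \<open>The two products are exchanged, and the one over the support of v is extended to G by
  factors with exponent 0.\<close>

lemma bext_chi:
  assumes "Poly_Mapping.keys v \<subseteq> elems T" "C \<subseteq> elems T"
  shows "bext H T v (chi C) = pairing H T v C"
proof -
  have fin: "finite C" using assms(2) by (rule finite_subset_elems)
  have lookup_chi: "Poly_Mapping.lookup (chi C) h = (if h \<in> C then 1 else 0)" for h
    using fin by (simp add: chi_def lookup_sum)
  have keys_chi: "Poly_Mapping.keys (chi C) = C"
    by (auto simp: in_keys_iff lookup_chi split: if_splits)
  have "bext H T v (chi C) = (\<Otimes>g\<in>Poly_Mapping.keys v. \<Otimes>h\<in>C. form T (g, h) [^] Poly_Mapping.lookup v g)"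
    unfolding bext_def keys_chi using assms
    by (intro finprod_cong)
      (auto simp: simp_implies_def lookup_chi subset_iff intro!: finprod_closed finprod_cong)
  also have "\<dots> = (\<Otimes>h\<in>C. \<Otimes>g\<in>Poly_Mapping.keys v. form T (g, h) [^] Poly_Mapping.lookup v g)"
    using assms fin by (intro finprod_swap) (auto simp: subset_iff)
  also have "\<dots> = pairing H T v C"
  proof -
    have "(\<Otimes>g\<in>Poly_Mapping.keys v. form T (g, h) [^] Poly_Mapping.lookup v g) =
        (\<Otimes>g\<in>elems T. form T (g, h) [^] Poly_Mapping.lookup v g)" if "h \<in> C" for h
      using assms that by (intro finprod_mono_neutral_cong_left) (auto simp: in_keys_iff)
    then show ?thesis
      unfolding pairing_def using assms
      by (intro finprod_cong) (auto simp: simp_implies_def subset_iff intro!: finprod_closed)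
  qed
  finally show ?thesis .
qed

text \<open>Passing to \<open>v - k s\<close> turns the condition at \<open>C\<close> into the vanishing of a function additive in \<open>C\<close>.\<close>

lemma Ann_iff:
  assumes "\<Union>\<CC> \<subseteq> elems T"
  shows "v \<in> Ann H T \<CC> \<longleftrightarrow> Poly_Mapping.keys v \<subseteq> nonbase T \<and>
    (\<exists>k. \<forall>C\<in>\<CC>. pairing H T (v - frag_cmul k (frag_of (base T))) C = \<one>)"
proof -
  have eq: "bext H T v (chi C) = bext H T (frag_of (base T)) (chi C) [^] k \<longleftrightarrow>
      pairing H T (v - frag_cmul k (frag_of (base T))) C = \<one>"
    if "Poly_Mapping.keys v \<subseteq> nonbase T" "C \<in> \<CC>" for k :: int and C
  proof -
    have C: "C \<subseteq> elems T" using assms that by auto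
    have "Poly_Mapping.keys v \<subseteq> elems T" using that nonbase_subset by blast
    then have "bext H T v (chi C) = bext H T (frag_of (base T)) (chi C) [^] k \<longleftrightarrow>
        pairing H T v C = pairing H T (frag_of (base T)) C [^] k"
      using C by (simp add: bext_chi)
    also have "\<dots> \<longleftrightarrow> pairing H T v C \<otimes> inv (pairing H T (frag_of (base T)) C [^] k) = \<one>"
      using C by (simp add: inv_solve_right')
    finally show ?thesis using C by (simp add: pairing_diff pairing_cmul)
  qed
  show ?thesis
  proof (cases "Poly_Mapping.keys v \<subseteq> nonbase T")
    case True
    then show ?thesis by (simp add: Ann_def eq[OF True])
  qed (simp add: Ann_def)
qed

text \<open>A condition that holds at every single element with a common k holds at every subset by
  additivity. It yields membership for all families of classes at once.\<close>

lemma AnnI: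
  assumes "\<Union>\<CC> \<subseteq> elems T" "Poly_Mapping.keys v \<subseteq> nonbase T"
    "\<And>h. h \<in> elems T \<Longrightarrow>
       pairing H T v {h} = form T (base T, h) [^] (k::int)"
  shows "v \<in> Ann H T \<CC>"
  unfolding Ann_iff[OF assms(1)]
proof (intro conjI exI[of _ k] ballI assms(2))
  fix C assume "C \<in> \<CC>"
  then have C: "C \<subseteq> elems T" using assms(1) by auto
  have single: "pairing H T (v - frag_cmul k (frag_of (base T))) {h} = \<one>" if "h \<in> elems T" for h
    using that assms(3)[OF that] by (simp add: pairing_diff pairing_cmul pairing_frag_of)
  show "pairing H T (v - frag_cmul k (frag_of (base T))) C = \<one>"
    by (rule pairing_Union_eq_one[OF partition_on_singletons C]) (use C single in blast)
qed

text \<open>The multiplier follows the group operations: k + l serves for a sum, -k for an inverse,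
  and 0 for the neutral element.\<close>

lemma subgroup_Ann:
  assumes "\<Union>\<CC> \<subseteq> elems T"
  shows "subgroup (Ann H T \<CC>) (free_Abelian_group (nonbase T))"
proof -
  have sub: "C \<subseteq> elems T" if "C \<in> \<CC>" for C using assms that by auto
  let ?s = "frag_of (base T)"
  show ?thesis
  proof
    show "Ann H T \<CC> \<subseteq> carrier (free_Abelian_group (nonbase T))"
      by (auto simp: Ann_def)
  next
    fix x y assume "x \<in> Ann H T \<CC>" "y \<in> Ann H T \<CC>"
    then obtain k l where
      x: "Poly_Mapping.keys x \<subseteq> nonbase T" "\<forall>C\<in>\<CC>. pairing H T (x - frag_cmul k ?s) C = \<one>" and
      y: "Poly_Mapping.keys y \<subseteq> nonbase T" "\<forall>C\<in>\<CC>. pairing H T (y - frag_cmul l ?s) C = \<one>"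
      unfolding Ann_iff[OF assms] by blast
    have "pairing H T (x + y - frag_cmul (k + l) ?s) C = \<one>" if "C \<in> \<CC>" for C
    proof -
      have "x + y - frag_cmul (k + l) ?s = (x - frag_cmul k ?s) + (y - frag_cmul l ?s)"
        by (simp add: frag_cmul_distrib)
      then show ?thesis using x(2) y(2) that by (simp only: pairing_add[OF sub] one_closed r_one)
    qed
    moreover have "Poly_Mapping.keys (x + y) \<subseteq> nonbase T"
      by (rule order_trans[OF keys_add]) (use x(1) y(1) in simp)
    ultimately show "x \<otimes>\<^bsub>free_Abelian_group (nonbase T)\<^esub> y \<in> Ann H T \<CC>"
      unfolding Ann_iff[OF assms] mult_free_Abelian_group by blast
  next
    show "\<one>\<^bsub>free_Abelian_group (nonbase T)\<^esub> \<in> Ann H T \<CC>"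
      using assms by (intro AnnI[where k = 0]) (simp_all add: pairing_def)
  next
    fix x assume "x \<in> Ann H T \<CC>"
    then obtain k where
      x: "Poly_Mapping.keys x \<subseteq> nonbase T" "\<forall>C\<in>\<CC>. pairing H T (x - frag_cmul k ?s) C = \<one>"
      unfolding Ann_iff[OF assms] by blast
    have "pairing H T (- x - frag_cmul (- k) ?s) C = \<one>" if "C \<in> \<CC>" for C
    proof -
      have "- x - frag_cmul (- k) ?s = - (x - frag_cmul k ?s)" by simp
      then show ?thesis using x(2) that by (simp only: pairing_uminus[OF sub] inv_one)
    qed
    then show "inv\<^bsub>free_Abelian_group (nonbase T)\<^esub> x \<in> Ann H T \<CC>"
      unfolding Ann_iff[OF assms] inv_free_Abelian_group[OF x(1)] keys_minus using x(1) by blast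
  qed
qed

text \<open>Each class of the coarser partition is a disjoint union of classes of the finer one, so
  the same k works.\<close>

lemma Ann_refines_mono:
  assumes "refines (elems T) P Q"
  shows "Ann H T P \<subseteq> Ann H T Q"
proof
  fix v assume v: "v \<in> Ann H T P"
  have P: "\<Union>P \<subseteq> elems T" and Q: "\<Union>Q \<subseteq> elems T"
    using assms by (auto simp: refines_def partition_on_def)
  from v obtain k where k: "Poly_Mapping.keys v \<subseteq> nonbase T"
    "\<And>C. C \<in> P \<Longrightarrow> pairing H T (v - frag_cmul k (frag_of (base T))) C = \<one>"
    unfolding Ann_iff[OF P] by blast
  have "pairing H T (v - frag_cmul k (frag_of (base T))) C = \<one>" if "C \<in> Q" for C
  proof (rule pairing_Union_eq_one[OF refines_obtains_subset[OF assms that]])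
    show "C \<subseteq> elems T" using Q that by blast
  qed (use k(2) in blast)
  with k(1) show "v \<in> Ann H T Q" unfolding Ann_iff[OF Q] by blast
qed

lemma Ann_add:
  assumes "\<Union>\<CC> \<subseteq> elems T" "v \<in> Ann H T \<CC>" "w \<in> Ann H T \<CC>"
  shows "v + w \<in> Ann H T \<CC>"
  using subgroup.m_closed[OF subgroup_Ann[OF assms(1)] assms(2,3)] by simp

lemma Ann_uminus:
  assumes "\<Union>\<CC> \<subseteq> elems T" "v \<in> Ann H T \<CC>"
  shows "- v \<in> Ann H T \<CC>"
proof -
  have "Poly_Mapping.keys v \<subseteq> nonbase T" using assms(2) by (simp add: Ann_def)
  then show ?thesis
    using subgroup.m_inv_closed[OF subgroup_Ann[OF assms(1)] assms(2)] by simp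
qed

lemma Ann_diff:
  assumes "\<Union>\<CC> \<subseteq> elems T" "v \<in> Ann H T \<CC>" "w \<in> Ann H T \<CC>"
  shows "v - w \<in> Ann H T \<CC>"
  using Ann_add[OF assms(1,2) Ann_uminus[OF assms(1,3)]] by simp

lemma zero_in_Ann: "\<Union>\<CC> \<subseteq> elems T \<Longrightarrow> 0 \<in> Ann H T \<CC>"
  using subgroup.one_closed[OF subgroup_Ann] by simp

section \<open>The derived partition and its monotonicity\<close>

text \<open>Two elements are related when they agree up to sign modulo the subgroup
  \<open>Ann H T \<CC>\<close>; signs multiply along a chain.\<close>

lemma equiv_ann_rel:
  assumes "\<Union>\<CC> \<subseteq> elems T"
  shows "equiv (nonbase T) (ann_rel H T \<CC>)"
proof (rule equivI)
  show "ann_rel H T \<CC> \<subseteq> nonbase T \<times> nonbase T"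
    by (auto simp: ann_rel_def)
  show "refl_on (nonbase T) (ann_rel H T \<CC>)"
    using zero_in_Ann[OF assms] by (auto simp: refl_on_def ann_rel_def)
  show "sym (ann_rel H T \<CC>)"
  proof (rule symI)
    fix a b assume "(a, b) \<in> ann_rel H T \<CC>"
    then show "(b, a) \<in> ann_rel H T \<CC>"
      using Ann_uminus[OF assms, of "frag_of a - frag_of b"]
      by (auto simp: ann_rel_def add.commute)
  qed
  show "trans (ann_rel H T \<CC>)"
  proof (rule transI)
    fix a b c
    assume "(a, b) \<in> ann_rel H T \<CC>" "(b, c) \<in> ann_rel H T \<CC>"
    then have nb: "a \<in> nonbase T" "c \<in> nonbase T"
      and ab: "frag_of a - frag_of b \<in> Ann H T \<CC> \<or> frag_of a + frag_of b \<in> Ann H T \<CC>"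
      and bc: "frag_of b - frag_of c \<in> Ann H T \<CC> \<or> frag_of b + frag_of c \<in> Ann H T \<CC>"
      by (auto simp: ann_rel_def)
    \<comment> \<open>The four combinations of signs: the middle element b cancels after adding the
      two members of the annulator if the first sign is minus, and after subtracting them if it is
      plus.\<close>
    have eqs: "frag_of a - frag_of b + (frag_of b - frag_of c) = frag_of a - frag_of c"
      "frag_of a - frag_of b + (frag_of b + frag_of c) = frag_of a + frag_of c"
      "frag_of a + frag_of b - (frag_of b - frag_of c) = frag_of a + frag_of c"
      "frag_of a + frag_of b - (frag_of b + frag_of c) = frag_of a - frag_of c"
      by simp_all
    have "frag_of a - frag_of c \<in> Ann H T \<CC> \<or> frag_of a + frag_of c \<in> Ann H T \<CC>"
      using ab bc Ann_add[OF assms] Ann_diff[OF assms] eqs by metis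
    with nb show "(a, c) \<in> ann_rel H T \<CC>" by (simp add: ann_rel_def)
  qed
qed

lemma base_in_derived_partition: "{base T} \<in> derived_partition H T \<CC>"
  by (simp add: derived_partition_def)

lemma partition_on_derived:
  assumes "\<Union>\<CC> \<subseteq> elems T"
  shows "partition_on (elems T) (derived_partition H T \<CC>)"
proof -
  have P: "partition_on (nonbase T) (nonbase T // ann_rel H T \<CC>)"
    by (rule partition_on_quotient[OF equiv_ann_rel[OF assms]])
  then have "disjnt {base T} (\<Union>(nonbase T // ann_rel H T \<CC>))"
    by (simp add: partition_on_def nonbase_def)
  then show ?thesis
    using P by (simp add: derived_partition_eq partition_on_insert nonbase_def)
qed

lemma derived_partition_cases:
  assumes "C \<in> derived_partition H T \<CC>"
  obtains "C = {base T}" | g where "g \<in> nonbase T" "C = ann_rel H T \<CC> `` {g}"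
  using assms by (auto simp: derived_partition_eq quotient_def)

lemma ann_rel_class_in_derived:
  "g \<in> nonbase T \<Longrightarrow> ann_rel H T \<CC> `` {g} \<in> derived_partition H T \<CC>"
  by (auto simp: derived_partition_eq quotient_def)

text \<open>A coarser partition has a larger annulator, hence a larger relation. Monotonicity makes
  the sequence increasing and its limit the least partition closed under the operator.\<close>

lemma derived_partition_refines_mono:
  assumes "refines (elems T) P Q"
  shows "refines (elems T) (derived_partition H T P) (derived_partition H T Q)"
  unfolding refines_def
proof (intro conjI ballI)
  show "partition_on (elems T) (derived_partition H T P)"
    "partition_on (elems T) (derived_partition H T Q)"
    using assms by (intro partition_on_derived; simp add: refines_def partition_on_def)+
next
  fix X assume "X \<in> derived_partition H T P"
  then show "\<exists>Y\<in>derived_partition H T Q. X \<subseteq> Y"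
  proof (cases rule: derived_partition_cases)
    case 1
    then show ?thesis using base_in_derived_partition by blast
  next
    case (2 g)
    have "ann_rel H T P \<subseteq> ann_rel H T Q"
      using Ann_refines_mono[OF assms] by (auto simp: ann_rel_def)
    with 2 show ?thesis
      using ann_rel_class_in_derived[of g Q] by blast
  qed
qed

lemma refines_singletons:
  assumes "partition_on (elems T) D"
  shows "refines (elems T) ((\<lambda>g. {g}) ` elems T) D"
  using assms partition_on_singletons unfolding refines_def
  by (auto simp: partition_on_def)

section \<open>The sequence of partitions and its stable value\<close>

lemma partition_seq_0: "partition_seq H T 0 = (\<lambda>g. {g}) ` elems T"
  and partition_seq_Suc: "partition_seq H T (Suc n) = derived_partition H T (partition_seq H T n)"
  by (simp_all add: partition_seq_def)

lemma partition_on_seq: "partition_on (elems T) (partition_seq H T n)"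
proof (induction n)
  case 0
  show ?case by (simp add: partition_seq_0 partition_on_singletons)
next
  case (Suc n)
  then show ?case
    unfolding partition_seq_Suc by (intro partition_on_derived) (simp add: partition_on_def)
qed

lemma Union_seq_subset: "\<Union>(partition_seq H T n) \<subseteq> elems T"
  using partition_on_seq[of n] by (simp add: partition_on_def)

lemma base_in_seq: "{base T} \<in> partition_seq H T n"
  by (cases n) (auto simp: partition_seq_0 partition_seq_Suc base_in_derived_partition)

text \<open>The partition into singletons refines every partition, and monotonicity propagates the
  first refinement along the sequence.\<close>

lemma partition_seq_refines_Suc:
  "refines (elems T) (partition_seq H T n) (partition_seq H T (Suc n))"
proof (induction n)
  case 0
  show ?case using refines_singletons[OF partition_on_seq[of "Suc 0"]] by (simp add: partition_seq_0)
next
  case (Suc n)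
  show ?case
    using derived_partition_refines_mono[OF Suc] by (simp only: partition_seq_Suc)
qed

lemma partition_seq_refines:
  assumes "m \<le> n"
  shows "refines (elems T) (partition_seq H T m) (partition_seq H T n)"
  using assms
proof (induction n rule: dec_induct)
  case base
  show ?case by (rule refines_refl[OF partition_on_seq])
next
  case (step n)
  then show ?case using refines_trans partition_seq_refines_Suc by blast
qed

text \<open>A finite set has finitely many partitions, so two terms of the sequence coincide; a
  monotone sequence that returns to a value has been constant in between, and a fixed point of the
  operator persists.\<close>

lemma stable_partition_eq_seq:
  obtains m where "stable_partition H T = partition_seq H T m"
    and "partition_seq H T (Suc m) = partition_seq H T m"
proof -
  have "range (partition_seq H T) \<subseteq> {P. partition_on (elems T) P}"
    using partition_on_seq by blast
  then have "finite (range (partition_seq H T))"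
    using finitely_many_partition_on[OF finite_elems] finite_subset by blast
  then have "\<not> inj (partition_seq H T)"
    using finite_imageD infinite_UNIV_nat by blast
  then obtain m n where mn: "m < n" "partition_seq H T m = partition_seq H T n"
    by (metis linorder_inj_onI')
  \<comment> \<open>The term after \<open>m\<close> lies between the equal terms \<open>m\<close>
    and \<open>n\<close> in the refinement order, so antisymmetry applies.\<close>
  have fixed: "partition_seq H T (Suc m) = partition_seq H T m"
    using partition_seq_refines[of m "Suc m"] partition_seq_refines[of "Suc m" n] mn
    by (intro refines_asym) auto
  have const: "partition_seq H T k = partition_seq H T m" if "m \<le> k" for k
    using that
  proof (induction k rule: dec_induct)
    case (step k)
    then show ?case using fixed by (simp add: partition_seq_Suc)
  qed simp
  have "stable_partition H T = partition_seq H T m"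
    unfolding stable_partition_def
  proof (rule the_equality)
    show "\<forall>\<^sub>F n in sequentially. partition_seq H T n = partition_seq H T m"
      using const eventually_sequentially by blast
  next
    fix \<CC> assume "\<forall>\<^sub>F n in sequentially. partition_seq H T n = \<CC>"
    then obtain N where "\<And>n. n \<ge> N \<Longrightarrow> partition_seq H T n = \<CC>"
      by (auto simp: eventually_sequentially)
    \<comment> \<open>Both eventual values are attained at the index \<open>max m N\<close>.\<close>
    then show "\<CC> = partition_seq H T m"
      using const[of "max m N"] by (metis max.cobounded1 max.cobounded2)
  qed
  with fixed show thesis by (intro that)
qed

lemma partition_on_stable: "partition_on (elems T) (stable_partition H T)"
proof -
  obtain m where "stable_partition H T = partition_seq H T m"
    by (rule stable_partition_eq_seq)
  then show ?thesis using partition_on_seq by simp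
qed

lemma base_in_stable: "{base T} \<in> stable_partition H T"
proof -
  obtain m where "stable_partition H T = partition_seq H T m"
    by (rule stable_partition_eq_seq)
  then show ?thesis using base_in_seq by simp
qed

lemma Union_stable_subset: "\<Union>(stable_partition H T) \<subseteq> elems T"
  using partition_on_stable by (simp add: partition_on_def)

lemma derived_stable: "derived_partition H T (stable_partition H T) = stable_partition H T"
proof -
  obtain m where "stable_partition H T = partition_seq H T m"
    "partition_seq H T (Suc m) = partition_seq H T m"
    by (rule stable_partition_eq_seq)
  then show ?thesis by (simp add: partition_seq_Suc)
qed

text \<open>Induction on n: the singletons refine D, and if the n-th term refines D, then its
  derived partition refines that of D, which refines D.\<close>

lemma partition_seq_refines_closed:
  assumes "refines (elems T) (derived_partition H T D) D"
  shows "refines (elems T) (partition_seq H T n) D"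
proof (induction n)
  case 0
  have "partition_on (elems T) D" using assms by (simp add: refines_def)
  then show ?case by (simp add: partition_seq_0 refines_singletons)
next
  case (Suc n)
  then show ?case
    using refines_trans[OF derived_partition_refines_mono assms] by (simp add: partition_seq_Suc)
qed

text \<open>The stable partition is a term of the sequence. This is the tool for bounding it from
  above by a partition built from another based matrix.\<close>

lemma stable_partition_least:
  assumes "refines (elems T) (derived_partition H T D) D"
  shows "refines (elems T) (stable_partition H T) D"
  using stable_partition_eq_seq partition_seq_refines_closed[OF assms] by metis

lemma partition_seq_refines_stable:
  "refines (elems T) (partition_seq H T n) (stable_partition H T)"
  by (rule partition_seq_refines_closed)
    (simp add: derived_stable refines_refl partition_on_stable)

section \<open>The quotient group and its cosets\<close>

abbreviation free_grp where "free_grp \<equiv> free_Abelian_group (nonbase T)"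

abbreviation stable_Ann where "stable_Ann \<equiv> Ann H T (stable_partition H T)"

lemma normal_stable_Ann: "stable_Ann \<lhd> free_grp"
  using comm_group.subgroup_imp_normal[OF abelian_free_Abelian_group]
    subgroup_Ann[OF Union_stable_subset] by blast

lemma comm_group_A_st: "comm_group (A_st H T)"
  unfolding A_st_def
  using comm_group.abelian_FactGroup[OF abelian_free_Abelian_group]
    subgroup_Ann[OF Union_stable_subset] by blast

lemma r_coset_in_A_st:
  assumes "Poly_Mapping.keys v \<subseteq> nonbase T"
  shows "stable_Ann #>\<^bsub>free_grp\<^esub> v \<in> carrier (A_st H T)"
  using assms by (auto simp: A_st_def FactGroup_def RCOSETS_def)

lemma r_coset_mult:
  assumes "Poly_Mapping.keys v \<subseteq> nonbase T" "Poly_Mapping.keys w \<subseteq> nonbase T"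
  shows "(stable_Ann #>\<^bsub>free_grp\<^esub> v) \<otimes>\<^bsub>A_st H T\<^esub> (stable_Ann #>\<^bsub>free_grp\<^esub> w)
      = stable_Ann #>\<^bsub>free_grp\<^esub> (v + w)"
  using normal.rcos_sum[OF normal_stable_Ann, of v w] assms by (simp add: A_st_def FactGroup_def)

lemma r_coset_eq_one_iff:
  assumes "Poly_Mapping.keys v \<subseteq> nonbase T"
  shows "stable_Ann #>\<^bsub>free_grp\<^esub> v = \<one>\<^bsub>A_st H T\<^esub> \<longleftrightarrow> v \<in> stable_Ann"
proof -
  have "stable_Ann #>\<^bsub>free_grp\<^esub> v = stable_Ann \<longleftrightarrow> v \<in> stable_Ann"
    using group.coset_join1[OF group_free_Abelian_group _ _ subgroup_Ann[OF Union_stable_subset]]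
      group.coset_join2[OF group_free_Abelian_group _ subgroup_Ann[OF Union_stable_subset]] assms
    by (metis carrier_free_Abelian_group_iff)
  then show ?thesis by (simp add: A_st_def FactGroup_def)
qed

lemma P_st_nonbase:
  "g \<in> nonbase T \<Longrightarrow> P_st H T g = stable_Ann #>\<^bsub>free_grp\<^esub> frag_of g"
  by (simp add: P_st_def nonbase_def)

lemma P_st_base: "P_st H T (base T) = \<one>\<^bsub>A_st H T\<^esub>"
  by (simp add: P_st_def)

lemma P_st_closed:
  assumes "g \<in> elems T"
  shows "P_st H T g \<in> carrier (A_st H T)"
proof (cases "g = base T")
  case True
  then show ?thesis
    using group.is_monoid[OF comm_group.axioms(2)[OF comm_group_A_st]]
    by (simp add: P_st_base monoid.one_closed)
next
  case False
  with assms have "g \<in> nonbase T" by (simp add: nonbase_def)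
  then show ?thesis by (simp add: P_st_nonbase r_coset_in_A_st)
qed

section \<open>Elements of every annulator and the axioms P1 to P3\<close>

lemma annihilating_in_Ann:
  assumes "annihilating H T g" "\<Union>\<CC> \<subseteq> elems T"
  shows "frag_of g \<in> Ann H T \<CC>"
  using assms nonbase_subset
  by (intro AnnI[where k = 0]) (auto simp: annihilating_def pairing_frag_of)

lemma core_in_Ann:
  assumes "core T g" "\<Union>\<CC> \<subseteq> elems T"
  shows "frag_of g \<in> Ann H T \<CC>"
proof (rule AnnI[where k = 1, OF assms(2)])
  have g: "g \<in> nonbase T" "g \<in> elems T" using assms(1) nonbase_subset by (auto simp: core_def)
  then show "Poly_Mapping.keys (frag_of g) \<subseteq> nonbase T" by simp
  show "pairing H T (frag_of g) {h} = form T (base T, h) [^] (1 :: int)" if "h \<in> elems T" for h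
    using that g assms(1) by (simp add: pairing_frag_of core_def)
qed

text \<open>The multiplier is k = 1, whatever the classes are. Besides giving P2, the generality in
  \<CC> puts the two elements added by \<open>M3\<close> into one class of each derived
  partition.\<close>

lemma complementary_in_Ann:
  assumes "complementary H T g1 g2" "\<Union>\<CC> \<subseteq> elems T"
  shows "frag_of g1 + frag_of g2 \<in> Ann H T \<CC>"
proof (rule AnnI[where k = 1, OF assms(2)])
  have g: "g1 \<in> nonbase T" "g1 \<in> elems T" "g2 \<in> nonbase T" "g2 \<in> elems T"
    using assms(1) nonbase_subset by (auto simp: complementary_def)
  then show "Poly_Mapping.keys (frag_of g1 + frag_of g2) \<subseteq> nonbase T"
    by (intro order_trans[OF keys_add]) simp
  show "pairing H T (frag_of g1 + frag_of g2) {h} = form T (base T, h) [^] (1 :: int)"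
    if "h \<in> elems T" for h
    using that g assms(1) by (simp add: pairing_add pairing_frag_of complementary_def)
qed

lemma triple_in_Ann:
  assumes "g1 \<in> nonbase T" "g2 \<in> nonbase T" "g3 \<in> nonbase T" "\<Union>\<CC> \<subseteq> elems T"
    and "\<And>h. h \<in> elems T \<Longrightarrow>
      form T (g1, h) \<otimes> form T (g2, h) \<otimes> form T (g3, h) = form T (base T, h)"
  shows "frag_of g1 + frag_of g2 + frag_of g3 \<in> Ann H T \<CC>"
proof (rule AnnI[where k = 1, OF assms(4)])
  have g: "g1 \<in> elems T" "g2 \<in> elems T" "g3 \<in> elems T"
    using assms(1-3) nonbase_subset by auto
  have "Poly_Mapping.keys (frag_of g1 + frag_of g2) \<subseteq> nonbase T"
    using assms(1,2) by (intro order_trans[OF keys_add]) simp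
  then show "Poly_Mapping.keys (frag_of g1 + frag_of g2 + frag_of g3) \<subseteq> nonbase T"
    using assms(3) by (intro order_trans[OF keys_add]) simp
  show "pairing H T (frag_of g1 + frag_of g2 + frag_of g3) {h} = form T (base T, h) [^] (1 :: int)"
    if "h \<in> elems T" for h
    using that g assms(5)[OF that] by (simp add: pairing_add pairing_frag_of)
qed

lemma P_st_annihilating: "annihilating H T g \<Longrightarrow> P_st H T g = \<one>\<^bsub>A_st H T\<^esub>"
  using annihilating_in_Ann[OF _ Union_stable_subset]
  by (simp add: P_st_nonbase annihilating_def r_coset_eq_one_iff)

lemma P_st_core: "core T g \<Longrightarrow> P_st H T g = \<one>\<^bsub>A_st H T\<^esub>"
  using core_in_Ann[OF _ Union_stable_subset]
  by (simp add: P_st_nonbase core_def r_coset_eq_one_iff)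

lemma keys_frag_add:
  assumes "Poly_Mapping.keys v \<subseteq> nonbase T" "g \<in> nonbase T"
  shows "Poly_Mapping.keys (v + frag_of g) \<subseteq> nonbase T"
  using assms by (intro order_trans[OF keys_add]) simp

lemma P_st_complementary:
  assumes "complementary H T g1 g2"
  shows "P_st H T g1 \<otimes>\<^bsub>A_st H T\<^esub> P_st H T g2 = \<one>\<^bsub>A_st H T\<^esub>"
proof -
  have "g1 \<in> nonbase T" "g2 \<in> nonbase T" using assms by (auto simp: complementary_def)
  then show ?thesis
    using complementary_in_Ann[OF assms Union_stable_subset]
    by (simp add: P_st_nonbase r_coset_mult r_coset_eq_one_iff keys_frag_add)
qed

lemma P_st_triple:
  assumes "g1 \<in> nonbase T" "g2 \<in> nonbase T" "g3 \<in> nonbase T"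
    and "\<And>h. h \<in> elems T \<Longrightarrow>
      form T (g1, h) \<otimes> form T (g2, h) \<otimes> form T (g3, h) = form T (base T, h)"
  shows "P_st H T g1 \<otimes>\<^bsub>A_st H T\<^esub> P_st H T g2 \<otimes>\<^bsub>A_st H T\<^esub> P_st H T g3 = \<one>\<^bsub>A_st H T\<^esub>"
  using assms(1-3) triple_in_Ann[OF assms(1-3) Union_stable_subset assms(4)]
  by (simp add: P_st_nonbase r_coset_mult r_coset_eq_one_iff keys_frag_add)

end

section \<open>Enlargements of a based matrix\<close>

text \<open>The common features of the three operations: e = 0 for \<open>M1\<close>, and e = 1 for
  \<open>M2\<close> and \<open>M3\<close>. The relation between new elements is required for all
  \<CC> because it is applied both to the terms of the sequence and to the stable partition.\<close>

locale based_matrix_enlargement = based_matrix_over H T + T': based_matrix_over H T'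
  for H :: "('h, 'm) monoid_scheme" (structure) and T T' :: "('g, 'h) based_matrix" +
  fixes N :: "'g set" and e :: int
  assumes enlarges: "enlarges_by H T N T'"
    and form_sum_new: "\<And>h. h \<in> elems T' \<Longrightarrow>
      (\<Otimes>n\<in>N. form T' (n, h)) = form T' (base T', h) [^] e"
    and new_related: "\<And>\<CC> m n. \<Union>\<CC> \<subseteq> elems T' \<Longrightarrow> m \<in> N \<Longrightarrow> n \<in> N \<Longrightarrow> (m, n) \<in> ann_rel H T' \<CC>"
begin

lemma elems_enlarged: "elems T' = elems T \<union> N"
  and base_enlarged [simp]: "base T' = base T"
  and new_disjoint: "N \<inter> elems T = {}"
  and form_enlarged: "g \<in> elems T \<Longrightarrow> h \<in> elems T \<Longrightarrow> form T' (g, h) = form T (g, h)"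
  using enlarges by (simp_all add: enlarges_by_def)

lemma elems_subset: "elems T \<subseteq> elems T'"
  and new_subset: "N \<subseteq> elems T'"
  and nonbase_enlarged_subset: "nonbase T \<subseteq> nonbase T'"
  and base_notin_new: "base T \<notin> N"
  using elems_enlarged new_disjoint base_in_elems by (auto simp: nonbase_def)

text \<open>New elements have coefficient 0 in w, so only values of the old form occur.\<close>

lemma pairing_enlarged:
  assumes "Poly_Mapping.keys w \<subseteq> elems T" "C \<subseteq> elems T"
  shows "pairing H T' w C = pairing H T w C"
proof -
  have "(\<Otimes>g\<in>elems T'. form T' (g, h) [^] Poly_Mapping.lookup w g) =
      (\<Otimes>g\<in>elems T. form T (g, h) [^] Poly_Mapping.lookup w g)" if "h \<in> C" for h
  proof (rule finprod_mono_neutral_cong_right[OF T'.finite_elems elems_subset])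
    have h: "h \<in> elems T" "h \<in> elems T'" using that assms(2) elems_subset by auto
    show "form T' (g, h) [^] Poly_Mapping.lookup w g = \<one>" if "g \<in> elems T' - elems T" for g
    proof -
      have "Poly_Mapping.lookup w g = 0" using that assms(1) by (auto simp: in_keys_iff)
      then show ?thesis by simp
    qed
    show "form T' (g, h) [^] Poly_Mapping.lookup w g = form T (g, h) [^] Poly_Mapping.lookup w g"
      if "g \<in> elems T" for g
      using that h by (simp add: form_enlarged)
    show "(\<lambda>g. form T' (g, h) [^] Poly_Mapping.lookup w g) \<in> elems T' \<rightarrow> carrier H"
      using h(2) by (intro Pi_I int_pow_closed T'.form_closed)
  qed
  moreover have "(\<Otimes>g\<in>elems T. form T (g, h) [^] Poly_Mapping.lookup w g) \<in> carrier H" if "h \<in> C" for h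
    using that assms(2) by (intro finprod_closed Pi_I int_pow_closed form_closed) auto
  ultimately show ?thesis
    unfolding pairing_def by (intro finprod_cong) (auto simp: simp_implies_def)
qed

lemma form_sum_new_right:
  assumes "g \<in> elems T'"
  shows "(\<Otimes>n\<in>N. form T' (g, n)) = form T' (g, base T) [^] e"
proof -
  have closed: "(\<lambda>n. form T' (n, g)) \<in> N \<rightarrow> carrier H"
    using assms new_subset by (intro Pi_I T'.form_closed) auto
  \<comment> \<open>Inverses are written as powers with exponent -1, so that they pass through the
    finite product and commute with the power e.\<close>
  have eq: "form T' (g, n) = form T' (n, g) [^] (- 1 :: int)" if "n \<in> elems T'" for n
    using T'.form_skew[OF that assms] T'.form_closed[OF that assms] int_pow_neg[of _ 1] by simp
  have "(\<Otimes>n\<in>N. form T' (g, n)) = (\<Otimes>n\<in>N. form T' (n, g) [^] (- 1 :: int))"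
    using eq new_subset closed
    by (intro finprod_cong) (auto simp: simp_implies_def subset_iff Pi_iff)
  also have "\<dots> = (form T' (base T, g) [^] e) [^] (- 1 :: int)"
    using finprod_int_pow[OF closed] form_sum_new[OF assms] by simp
  also have "\<dots> = (form T' (base T, g) [^] (- 1 :: int)) [^] e"
    using assms T'.base_in_elems by (simp only: int_pow_pow T'.form_closed base_enlarged mult.commute)
  also have "\<dots> = form T' (g, base T) [^] e"
    using eq[of "base T"] T'.base_in_elems by simp
  finally show ?thesis .
qed

text \<open>For each g the product over N collapses to b(g, s) to the power e by
  \<open>form_sum_new_right\<close>. Hence the condition at N is a consequence of the one at
  {s}.\<close>

lemma pairing_new:
  "pairing H T' w N = pairing H T' w {base T} [^] e"
proof -
  have base: "base T \<in> elems T'" using T'.base_in_elems by simp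
  have fin: "finite N" using new_subset by (rule T'.finite_subset_elems)
  have closed: "form T' (g, n) \<in> carrier H" if "g \<in> elems T'" "n \<in> N" for g n
    using that new_subset by auto
  have "pairing H T' w N = (\<Otimes>g\<in>elems T'. \<Otimes>n\<in>N. form T' (g, n) [^] Poly_Mapping.lookup w g)"
    unfolding pairing_def using fin closed by (intro finprod_swap) auto
  also have "\<dots> = (\<Otimes>g\<in>elems T'. (form T' (g, base T) [^] Poly_Mapping.lookup w g) [^] e)"
  proof (rule finprod_cong')
    fix g assume g: "g \<in> elems T'"
    have "(\<Otimes>n\<in>N. form T' (g, n) [^] Poly_Mapping.lookup w g)
        = (\<Otimes>n\<in>N. form T' (g, n)) [^] Poly_Mapping.lookup w g"
      using closed[OF g] by (intro finprod_int_pow) auto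
    also have "\<dots> = (form T' (g, base T) [^] Poly_Mapping.lookup w g) [^] e"
      using g base by (simp only: form_sum_new_right int_pow_pow T'.form_closed mult.commute)
    finally show "(\<Otimes>n\<in>N. form T' (g, n) [^] Poly_Mapping.lookup w g)
        = (form T' (g, base T) [^] Poly_Mapping.lookup w g) [^] e" .
  qed (use base in \<open>auto intro!: int_pow_closed T'.form_closed\<close>)
  also have "\<dots> = pairing H T' w {base T} [^] e"
    using base finprod_int_pow[of "\<lambda>g. form T' (g, base T) [^] Poly_Mapping.lookup w g" "elems T'" e]
    by (simp add: pairing_def Pi_iff finprod_closed)
  finally show ?thesis .
qed

text \<open>The part of C inside N is empty or all of N; in the second case
  \<open>pairing_new\<close> and the condition at {s} make its contribution neutral.\<close>

lemma pairing_enlarged_class: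
  assumes "Poly_Mapping.keys w \<subseteq> elems T" "C \<subseteq> elems T'" "N \<inter> C = {} \<or> N \<subseteq> C"
    and base: "pairing H T' w {base T} = \<one>"
  shows "pairing H T' w C = pairing H T w (elems T \<inter> C)"
proof -
  have "N \<inter> C = {} \<or> N \<inter> C = N" using assms(3) by auto
  then have "pairing H T' w (N \<inter> C) = \<one>"
    using base by (auto simp: pairing_new)
  moreover have "pairing H T' w C = pairing H T' w (elems T \<inter> C) \<otimes> pairing H T' w (N \<inter> C)"
  proof -
    have C: "C = elems T \<inter> C \<union> N \<inter> C" using assms(2) elems_enlarged by auto
    have "pairing H T' w (elems T \<inter> C \<union> N \<inter> C) = pairing H T' w (elems T \<inter> C) \<otimes> pairing H T' w (N \<inter> C)"
      using elems_subset new_subset new_disjoint by (intro T'.pairing_Un_disjoint) auto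
    then show ?thesis using C by simp
  qed
  ultimately show ?thesis
    using assms(1) by (simp add: pairing_enlarged)
qed

section \<open>Restriction of partitions to the old elements\<close>

text \<open>Classes contained in N leave an empty trace, which is removed because a partition has no
  empty member.\<close>

abbreviation restrict_partition :: "'g set set \<Rightarrow> 'g set set" where
  "restrict_partition D \<equiv> (\<inter>) (elems T) ` D - {{}}"

lemma partition_on_restrict_partition:
  "partition_on (elems T') D \<Longrightarrow> partition_on (elems T) (restrict_partition D)"
  using partition_on_restrict[of "elems T'" D "elems T"] elems_subset by (simp add: Int_absorb2)

lemma Ann_enlarged_iff:
  assumes "\<Union>D \<subseteq> elems T'" "Poly_Mapping.keys v \<subseteq> nonbase T"
  shows "v \<in> Ann H T' D \<longleftrightarrow>
    (\<exists>k. \<forall>C\<in>D. pairing H T' (v - frag_cmul k (frag_of (base T))) C = \<one>)"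
  using assms(2) nonbase_enlarged_subset by (auto simp: T'.Ann_iff[OF assms(1)])

lemma keys_shift_subset:
  assumes "Poly_Mapping.keys v \<subseteq> nonbase T"
  shows "Poly_Mapping.keys (v - frag_cmul k (frag_of (base T))) \<subseteq> elems T"
proof (rule order_trans[OF keys_diff], rule Un_least)
  show "Poly_Mapping.keys v \<subseteq> elems T" using assms nonbase_subset by blast
  show "Poly_Mapping.keys (frag_cmul k (frag_of (base T))) \<subseteq> elems T"
    by (rule order_trans[OF keys_cmul]) simp
qed

text \<open>The same k works. Classes inside N are allowed here: their traces are empty, so they
  impose nothing on G. This covers the singletons with which the sequence of the enlarged matrix
  starts.\<close>

lemma Ann_restrict_partitionI:
  assumes D: "partition_on (elems T') D" "{base T} \<in> D"
    and new: "\<And>C. C \<in> D \<Longrightarrow> N \<inter> C = {} \<or> N \<subseteq> C \<or> C \<subseteq> N"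
    and v: "v \<in> Ann H T' D" "Poly_Mapping.keys v \<subseteq> nonbase T"
  shows "v \<in> Ann H T (restrict_partition D)"
proof -
  have D': "\<Union>D \<subseteq> elems T'" using D(1) by (simp add: partition_on_def)
  obtain k where k: "\<And>C. C \<in> D \<Longrightarrow> pairing H T' (v - frag_cmul k (frag_of (base T))) C = \<one>"
    using v(1) unfolding Ann_enlarged_iff[OF D' v(2)] by blast
  have "pairing H T (v - frag_cmul k (frag_of (base T))) C = \<one>" if C: "C \<in> restrict_partition D" for C
  proof -
    obtain C' where C': "C' \<in> D" "C = elems T \<inter> C'" "C \<noteq> {}" using C by blast
    then have "N \<inter> C' = {} \<or> N \<subseteq> C'" using new[of C'] new_disjoint by blast
    then show ?thesis
      using pairing_enlarged_class[OF keys_shift_subset[OF v(2)] _ _ k[OF D(2)], of C'] k[OF C'(1)]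
        C'(2) Union_upper[OF C'(1)] D' by simp
  qed
  then show ?thesis
    using v(2) by (subst Ann_iff) auto
qed

text \<open>In this direction no class may be a proper nonempty part of N, since it could impose a
  condition that is invisible on G. With N undivided, the condition at {s} controls the contribution
  of N.\<close>

lemma Ann_restrict_partitionD:
  assumes D: "partition_on (elems T') D" "{base T} \<in> D"
    and new: "\<And>C. C \<in> D \<Longrightarrow> N \<inter> C = {} \<or> N \<subseteq> C"
    and v: "v \<in> Ann H T (restrict_partition D)"
  shows "v \<in> Ann H T' D"
proof -
  have D': "\<Union>D \<subseteq> elems T'" using D(1) by (simp add: partition_on_def)
  have "\<Union>(restrict_partition D) \<subseteq> elems T" by auto
  note v' = v[unfolded Ann_iff[OF this]]
  have keys: "Poly_Mapping.keys v \<subseteq> nonbase T" using v' by (rule conjunct1)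
  obtain k where
    "\<forall>C\<in>restrict_partition D. pairing H T (v - frag_cmul k (frag_of (base T))) C = \<one>"
    using conjunct2[OF v'] by (rule exE)
  then have k: "pairing H T (v - frag_cmul k (frag_of (base T))) C = \<one>"
    if "C \<in> restrict_partition D" for C
    using that by (rule bspec)
  \<comment> \<open>The class {s} is its own trace, so its condition passes unchanged between the
    two matrices.\<close>
  have base: "pairing H T' (v - frag_cmul k (frag_of (base T))) {base T} = \<one>"
  proof -
    have eq: "elems T \<inter> {base T} = {base T}" using base_in_elems by blast
    then have "elems T \<inter> {base T} \<in> restrict_partition D"
      using D(2) by blast
    then have "pairing H T (v - frag_cmul k (frag_of (base T))) {base T} = \<one>"
      unfolding eq by (rule k)
    then show ?thesis
      using pairing_enlarged[OF keys_shift_subset[OF keys], of "{base T}"] base_in_elems by simp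
  qed
  have "pairing H T' (v - frag_cmul k (frag_of (base T))) C = \<one>" if C: "C \<in> D" for C
  proof -
    have "pairing H T' (v - frag_cmul k (frag_of (base T))) C
        = pairing H T (v - frag_cmul k (frag_of (base T))) (elems T \<inter> C)"
      using D' C new[OF C] by (intro pairing_enlarged_class[OF keys_shift_subset[OF keys] _ _ base]) auto
    also have "\<dots> = \<one>"
    proof (cases "elems T \<inter> C = {}")
      case False
      with C show ?thesis by (intro k) blast
    qed (simp only: pairing_empty)
    finally show ?thesis .
  qed
  then show ?thesis unfolding Ann_enlarged_iff[OF D' keys] by blast
qed

text \<open>The elements of N are mutually related, so a class that contains one of them contains
  all; {s} contains none.\<close>

lemma new_in_derived_class:
  assumes "\<Union>\<CC> \<subseteq> elems T'" "C \<in> derived_partition H T' \<CC>"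
  shows "N \<inter> C = {} \<or> N \<subseteq> C"
  using assms(2)
proof (cases rule: T'.derived_partition_cases)
  case 1
  then show ?thesis using base_notin_new by simp
next
  case (2 g)
  have "n \<in> C" if "m \<in> N" "m \<in> C" "n \<in> N" for m n
    using T'.equiv_ann_rel[OF assms(1)] new_related[OF assms(1) that(1,3)] that(2) 2
    by (auto elim!: equivE dest: transD)
  then show ?thesis by blast
qed

lemma new_in_seq_class:
  assumes "C \<in> partition_seq H T' n"
  shows "N \<inter> C = {} \<or> N \<subseteq> C \<or> C \<subseteq> N"
proof (cases n)
  case 0
  then show ?thesis using assms by (auto simp: T'.partition_seq_0)
next
  case (Suc m)
  then show ?thesis
    using assms new_in_derived_class[OF T'.Union_seq_subset, of C m] by (auto simp: T'.partition_seq_Suc)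
qed

lemma Ann_restrict_seqI:
  assumes "v \<in> Ann H T' (partition_seq H T' n)" "Poly_Mapping.keys v \<subseteq> nonbase T"
  shows "v \<in> Ann H T (restrict_partition (partition_seq H T' n))"
  using assms T'.base_in_seq new_in_seq_class
  by (intro Ann_restrict_partitionI[OF T'.partition_on_seq]) auto

lemma restrict_seq_refines:
  "refines (elems T) (restrict_partition (partition_seq H T' n)) (partition_seq H T n)"
proof (induction n)
  case 0
  show ?case
    unfolding refines_def
    using partition_on_restrict_partition[OF T'.partition_on_seq[of 0]] partition_on_seq[of 0]
    by (auto simp: partition_seq_0 T'.partition_seq_0)
next
  case (Suc n)
  have Ann: "v \<in> Ann H T (partition_seq H T n)"
    if "v \<in> Ann H T' (partition_seq H T' n)" "Poly_Mapping.keys v \<subseteq> nonbase T" for v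
    using Ann_restrict_seqI[OF that] Ann_refines_mono[OF Suc] by blast
  show ?case
    unfolding refines_def
  proof (intro conjI ballI partition_on_seq partition_on_restrict_partition T'.partition_on_seq)
    fix X assume "X \<in> restrict_partition (partition_seq H T' (Suc n))"
    then obtain C where C: "C \<in> derived_partition H T' (partition_seq H T' n)"
      "X = elems T \<inter> C" "X \<noteq> {}"
      by (auto simp: T'.partition_seq_Suc)
    from C(1) show "\<exists>Y\<in>partition_seq H T (Suc n). X \<subseteq> Y"
    proof (cases rule: T'.derived_partition_cases)
      case 1
      then show ?thesis using base_in_seq[of "Suc n"] C(2) by auto
    next
      case (2 g)
      obtain x where x: "x \<in> X" using C(3) by blast
      let ?r = "ann_rel H T' (partition_seq H T' n)"
      have equiv: "equiv (nonbase T') ?r"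
        by (rule T'.equiv_ann_rel[OF T'.Union_seq_subset])
      have "x \<in> nonbase T'" "x \<in> elems T"
        using x C(2) 2 by (auto simp: ann_rel_def)
      then have x': "x \<in> nonbase T" by (simp add: nonbase_def)
      have "X \<subseteq> ann_rel H T (partition_seq H T n) `` {x}"
      proof
        fix y assume y: "y \<in> X"
        have "(x, y) \<in> ?r"
          using x y C(2) 2 equiv by (auto elim!: equivE dest: transD symD)
        moreover have "y \<in> nonbase T"
          using y C(2) 2 by (auto simp: ann_rel_def nonbase_def)
        moreover have "Poly_Mapping.keys (frag_of x - frag_of y) \<subseteq> nonbase T"
          "Poly_Mapping.keys (frag_of x + frag_of y) \<subseteq> nonbase T"
          by (rule order_trans[OF keys_diff], use x' \<open>y \<in> nonbase T\<close> in simp,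
              rule order_trans[OF keys_add], use x' \<open>y \<in> nonbase T\<close> in simp)
        ultimately have "(x, y) \<in> ann_rel H T (partition_seq H T n)"
          using Ann x' unfolding ann_rel_def by blast
        then show "y \<in> ann_rel H T (partition_seq H T n) `` {x}" by simp
      qed
      then show ?thesis
        unfolding partition_seq_Suc using ann_rel_class_in_derived[OF x'] by blast
    qed
  qed
qed

lemma stable_refines_restrict:
  "refines (elems T) (stable_partition H T) (restrict_partition (stable_partition H T'))"
proof (rule stable_partition_least)
  let ?D' = "stable_partition H T'"
  let ?D = "restrict_partition ?D'"
  have Ann: "Ann H T ?D \<subseteq> Ann H T' ?D'"
    using T'.base_in_stable new_in_derived_class[OF T'.Union_stable_subset]
    by (intro subsetI Ann_restrict_partitionD[OF T'.partition_on_stable]) (auto simp: T'.derived_stable)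
  then have rel: "ann_rel H T ?D \<subseteq> ann_rel H T' ?D'"
    using nonbase_enlarged_subset unfolding ann_rel_def by blast
  show "refines (elems T) (derived_partition H T ?D) ?D"
    unfolding refines_def
  proof (intro conjI ballI partition_on_derived partition_on_restrict_partition T'.partition_on_stable)
    show "\<Union>?D \<subseteq> elems T" by auto
    fix X assume "X \<in> derived_partition H T ?D"
    then show "\<exists>Y\<in>?D. X \<subseteq> Y"
    proof (cases rule: derived_partition_cases)
      case 1
      have "elems T \<inter> {base T} \<in> ?D" using T'.base_in_stable by auto
      with 1 show ?thesis by auto
    next
      case (2 g)
      have g: "g \<in> elems T" "g \<in> nonbase T'" using 2 nonbase_subset nonbase_enlarged_subset by auto
      have mem: "ann_rel H T' ?D' `` {g} \<in> ?D'"
        using T'.ann_rel_class_in_derived[OF g(2), of ?D'] by (simp add: T'.derived_stable)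
      have "g \<in> ann_rel H T' ?D' `` {g}"
        using equiv_class_self[OF T'.equiv_ann_rel[OF T'.Union_stable_subset] g(2)] .
      with g mem have "elems T \<inter> ann_rel H T' ?D' `` {g} \<in> ?D" by blast
      moreover have "X \<subseteq> elems T \<inter> ann_rel H T' ?D' `` {g}"
        using 2 rel nonbase_subset by (auto simp: ann_rel_def)
      ultimately show ?thesis by blast
    qed
  qed
qed

lemma Ann_stable_enlarged:
  "Ann H T (stable_partition H T) =
     Ann H T' (stable_partition H T') \<inter> carrier (free_Abelian_group (nonbase T))"
proof (intro equalityI subsetI IntI)
  fix v assume v: "v \<in> Ann H T (stable_partition H T)"
  then have "v \<in> Ann H T (restrict_partition (stable_partition H T'))"
    using Ann_refines_mono[OF stable_refines_restrict] by blast
  then show "v \<in> Ann H T' (stable_partition H T')"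
    using T'.base_in_stable new_in_derived_class[OF T'.Union_stable_subset]
    by (intro Ann_restrict_partitionD[OF T'.partition_on_stable]) (auto simp: T'.derived_stable)
  show "v \<in> carrier (free_Abelian_group (nonbase T))"
    using v by (simp add: Ann_def)
next
  fix v assume "v \<in> Ann H T' (stable_partition H T') \<inter> carrier (free_Abelian_group (nonbase T))"
  moreover obtain m where "stable_partition H T' = partition_seq H T' m"
    by (rule T'.stable_partition_eq_seq)
  ultimately have "v \<in> Ann H T' (partition_seq H T' m)" "Poly_Mapping.keys v \<subseteq> nonbase T"
    by simp_all
  then have "v \<in> Ann H T (restrict_partition (partition_seq H T' m))"
    by (rule Ann_restrict_seqI)
  moreover have "refines (elems T) (restrict_partition (partition_seq H T' m)) (stable_partition H T)"
    using restrict_seq_refines partition_seq_refines_stable by (rule refines_trans)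
  ultimately show "v \<in> Ann H T (stable_partition H T)"
    using Ann_refines_mono by blast
qed

lemma A_st_mon:
  "\<exists>\<phi>\<in>mon (A_st H T) (A_st H T'). \<forall>g\<in>elems T. P_st H T' g = \<phi> (P_st H T g)"
proof -
  define f where "f v = T'.stable_Ann #>\<^bsub>T'.free_grp\<^esub> v" for v
  have keys: "Poly_Mapping.keys v \<subseteq> nonbase T'" if "v \<in> carrier free_grp" for v
    using that nonbase_enlarged_subset by simp
  have hom: "f \<in> hom free_grp (A_st H T')"
  proof (rule homI)
    show "f v \<in> carrier (A_st H T')" if "v \<in> carrier free_grp" for v
      unfolding f_def by (rule T'.r_coset_in_A_st[OF keys[OF that]])
    show "f (v \<otimes>\<^bsub>free_grp\<^esub> w) = f v \<otimes>\<^bsub>A_st H T'\<^esub> f w"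
      if "v \<in> carrier free_grp" "w \<in> carrier free_grp" for v w
      unfolding f_def by (simp add: T'.r_coset_mult[OF keys[OF that(1)] keys[OF that(2)]])
  qed
  interpret f: group_hom free_grp "A_st H T'" f
    using hom comm_group.axioms(2)[OF T'.comm_group_A_st]
    by (simp add: group_hom_def group_hom_axioms_def)
  have "f v = \<one>\<^bsub>A_st H T'\<^esub> \<longleftrightarrow> v \<in> T'.stable_Ann" if "v \<in> carrier free_grp" for v
    unfolding f_def by (rule T'.r_coset_eq_one_iff[OF keys[OF that]])
  then have kernel: "kernel free_grp (A_st H T') f = stable_Ann"
    unfolding kernel_def Ann_stable_enlarged by blast
  define \<phi> where "\<phi> X = the_elem (f ` X)" for X
  have mon: "\<phi> \<in> mon (A_st H T) (A_st H T')"
    using f.FactGroup_hom f.FactGroup_inj_on unfolding kernel A_st_def[of H T] \<phi>_def mon_def by simp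
  have \<phi>_coset: "\<phi> (stable_Ann #>\<^bsub>free_grp\<^esub> v) = f v" if v: "v \<in> carrier free_grp" for v
  proof -
    have const: "f x = f v" if x: "x \<in> stable_Ann #>\<^bsub>free_grp\<^esub> v" for x
    proof -
      obtain a where a: "a \<in> stable_Ann" "x = a + v"
        using x by (auto simp: r_coset_def)
      have "a \<in> carrier free_grp" "f a = \<one>\<^bsub>A_st H T'\<^esub>"
        using a(1) unfolding kernel[symmetric] kernel_def by auto
      then show ?thesis
        using f.hom_mult[of a v] v a(2) f.hom_closed[OF v] by simp
    qed
    have "v \<in> stable_Ann #>\<^bsub>free_grp\<^esub> v"
      using group.rcos_self[OF group_free_Abelian_group v subgroup_Ann[OF Union_stable_subset]] .
    then have "stable_Ann #>\<^bsub>free_grp\<^esub> v \<noteq> {}" by blast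
    then show ?thesis
      unfolding \<phi>_def by (rule the_elem_image_unique) (rule const)
  qed
  have "P_st H T' g = \<phi> (P_st H T g)" if g: "g \<in> elems T" for g
  proof (cases "g = base T")
    case True
    have "stable_Ann #>\<^bsub>free_grp\<^esub> 0 = \<one>\<^bsub>A_st H T\<^esub>"
      using zero_in_Ann[OF Union_stable_subset] by (simp add: r_coset_eq_one_iff)
    moreover have "f 0 = \<one>\<^bsub>A_st H T'\<^esub>" using f.hom_one by simp
    ultimately show ?thesis
      using True \<phi>_coset[of 0] T'.P_st_base by (simp add: P_st_base)
  next
    case False
    with g have "g \<in> nonbase T" by (simp add: nonbase_def)
    then show ?thesis
      using \<phi>_coset[of "frag_of g"] nonbase_enlarged_subset
      by (simp add: P_st_nonbase T'.P_st_nonbase f_def subset_iff)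
  qed
  with mon show ?thesis by blast
qed

end

lemma (in comm_group) based_matrix_over: "based_matrix G T \<Longrightarrow> based_matrix_over G T"
  by (intro based_matrix_over.intro based_matrix_over_axioms.intro) (rule comm_group_axioms)

lemma (in comm_group) enlargementI:
  assumes "enlarges_by G T N T'"
    and "\<And>h. h \<in> elems T' \<Longrightarrow> (\<Otimes>n\<in>N. form T' (n, h)) = form T' (base T', h) [^] (e :: int)"
    and "\<And>\<CC> m n. \<Union>\<CC> \<subseteq> elems T' \<Longrightarrow> m \<in> N \<Longrightarrow> n \<in> N \<Longrightarrow> (m, n) \<in> ann_rel G T' \<CC>"
  shows "based_matrix_enlargement G T T' N e"
proof -
  have "based_matrix G T" "based_matrix G T'" using assms(1) by (simp_all add: enlarges_by_def)
  then show ?thesis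
    by (intro based_matrix_enlargement.intro based_matrix_enlargement_axioms.intro
        based_matrix_over assms)
qed

lemma (in comm_group) M1_enlargement:
  assumes "M1 G T T'"
  obtains N e where "based_matrix_enlargement G T T' N e"
proof -
  obtain g where enl: "enlarges_by G T {g} T'" and g: "annihilating G T' g"
    using assms by (auto simp: M1_def)
  interpret T': based_matrix_over G T'
    using enl by (intro based_matrix_over) (simp add: enlarges_by_def)
  have "based_matrix_enlargement G T T' {g} 0"
  proof (rule enlargementI[OF enl])
    show "(\<Otimes>n\<in>{g}. form T' (n, h)) = form T' (base T', h) [^] (0 :: int)" if "h \<in> elems T'" for h
      using that g by (simp add: annihilating_def)
    show "(m, n) \<in> ann_rel G T' \<CC>" if "\<Union>\<CC> \<subseteq> elems T'" "m \<in> {g}" "n \<in> {g}" for \<CC> m n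
      using that g T'.zero_in_Ann[OF that(1)] by (simp add: ann_rel_def annihilating_def)
  qed
  then show thesis by (rule that)
qed

lemma (in comm_group) M2_enlargement:
  assumes "M2 G T T'"
  obtains N e where "based_matrix_enlargement G T T' N e"
proof -
  obtain g where enl: "enlarges_by G T {g} T'" and g: "core T' g"
    using assms by (auto simp: M2_def)
  interpret T': based_matrix_over G T'
    using enl by (intro based_matrix_over) (simp add: enlarges_by_def)
  have "based_matrix_enlargement G T T' {g} 1"
  proof (rule enlargementI[OF enl])
    show "(\<Otimes>n\<in>{g}. form T' (n, h)) = form T' (base T', h) [^] (1 :: int)" if "h \<in> elems T'" for h
      using that g by (simp add: core_def)
    show "(m, n) \<in> ann_rel G T' \<CC>" if "\<Union>\<CC> \<subseteq> elems T'" "m \<in> {g}" "n \<in> {g}" for \<CC> m n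
      using that g T'.zero_in_Ann[OF that(1)] by (simp add: ann_rel_def core_def)
  qed
  then show thesis by (rule that)
qed

lemma (in comm_group) M3_enlargement:
  assumes "M3 G T T'"
  obtains N e where "based_matrix_enlargement G T T' N e"
proof -
  obtain g g' where neq: "g \<noteq> g'" and enl: "enlarges_by G T {g, g'} T'"
    and compl: "complementary G T' g g'"
    using assms by (auto simp: M3_def)
  interpret T': based_matrix_over G T'
    using enl by (intro based_matrix_over) (simp add: enlarges_by_def)
  have nb: "g \<in> nonbase T'" "g' \<in> nonbase T'" using compl by (simp_all add: complementary_def)
  then have el: "g \<in> elems T'" "g' \<in> elems T'" using T'.nonbase_subset by auto
  have "based_matrix_enlargement G T T' {g, g'} 1"
  proof (rule enlargementI[OF enl])
    show "(\<Otimes>n\<in>{g, g'}. form T' (n, h)) = form T' (base T', h) [^] (1 :: int)" if "h \<in> elems T'" for h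
      using that compl neq el by (simp add: complementary_def)
    show "(m, n) \<in> ann_rel G T' \<CC>" if "\<Union>\<CC> \<subseteq> elems T'" "m \<in> {g, g'}" "n \<in> {g, g'}" for \<CC> m n
      using that(2,3) nb T'.zero_in_Ann[OF that(1)] T'.complementary_in_Ann[OF compl that(1)]
      by (auto simp: ann_rel_def add.commute)
  qed
  then show thesis by (rule that)
qed

theorem corollary1:
  fixes H :: "('h, 'm) monoid_scheme"
  assumes "comm_group H"
  shows "parity_functor H
           (A_st H :: ('g, 'h) based_matrix \<Rightarrow> ('g \<Rightarrow>\<^sub>0 int) set monoid)
           (P_st H)"
proof -
  interpret H: comm_group H by (rule assms)
  show ?thesis
    unfolding parity_functor_def
  proof (intro conjI allI impI ballI)
    fix T :: "('g, 'h) based_matrix"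
    assume "based_matrix H T"
    then interpret based_matrix_over H T by (rule H.based_matrix_over)
    show "comm_group (A_st H T)" by (rule comm_group_A_st)
    show "P_st H T \<in> elems T \<rightarrow> carrier (A_st H T)" using P_st_closed by blast
  next
    fix T T' :: "('g, 'h) based_matrix"
    assume "M1 H T T' \<or> M2 H T T' \<or> M3 H T T'"
    then obtain N e where "based_matrix_enlargement H T T' N e"
      using H.M1_enlargement H.M2_enlargement H.M3_enlargement by metis
    then show "\<exists>\<phi>\<in>mon (A_st H T) (A_st H T'). \<forall>g\<in>elems T. P_st H T' g = \<phi> (P_st H T g)"
      by (rule based_matrix_enlargement.A_st_mon)
  next
    fix T :: "('g, 'h) based_matrix" and g
    assume "based_matrix H T"
    then interpret based_matrix_over H T by (rule H.based_matrix_over)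
    assume "annihilating H T g \<or> core T g \<or> g = base T"
    then show "P_st H T g = \<one>\<^bsub>A_st H T\<^esub>"
      using P_st_annihilating P_st_core P_st_base by blast
  next
    fix T :: "('g, 'h) based_matrix" and g1 g2
    assume "based_matrix H T"
    then interpret based_matrix_over H T by (rule H.based_matrix_over)
    assume "complementary H T g1 g2"
    then show "P_st H T g1 \<otimes>\<^bsub>A_st H T\<^esub> P_st H T g2 = \<one>\<^bsub>A_st H T\<^esub>"
      by (rule P_st_complementary)
  next
    fix T :: "('g, 'h) based_matrix" and g1 g2 g3
    assume "based_matrix H T"
    then interpret based_matrix_over H T by (rule H.based_matrix_over)
    assume "g1 \<in> nonbase T" "g2 \<in> nonbase T" "g3 \<in> nonbase T"
      "\<forall>h\<in>elems T. form T (g1, h) \<otimes>\<^bsub>H\<^esub> form T (g2, h) \<otimes>\<^bsub>H\<^esub> form T (g3, h) = form T (base T, h)"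
    then show "P_st H T g1 \<otimes>\<^bsub>A_st H T\<^esub> P_st H T g2 \<otimes>\<^bsub>A_st H T\<^esub> P_st H T g3 = \<one>\<^bsub>A_st H T\<^esub>"
      using P_st_triple by blast
  qed
qed

end
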